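(* Let $\alpha>0$. The Laguerre weight $w_\alpha(x)=x^\alpha e^{-x}$, $x\in(0,\infty)$, is separable: with $$\mathfrak{a}_m=\sqrt{\frac{m!}{2\,\Gamma(m+1+\alpha)}},\qquad \mathfrak{b}_n=\sqrt{\frac{\Gamma(n+1+\alpha)}{2\,n!}},\qquad m,n\in\mathbb{Z}_+,$$ its differentiation matrix satisfies $\mathcal{D}_{m,n}=-\mathfrak{a}_m\mathfrak{b}_n$ for $m\ge n+1$, $\mathcal{D}_{m,m}=0$, and $\mathcal{D}_{m,n}=\mathfrak{a}_n\mathfrak{b}_m$ for $m\le n-1$.
   Context: $\mathbb{Z}_+=\{0,1,2,\dots\}$. The orthonormal polynomials are $p_n(x)=\sqrt{n!/\Gamma(n+1+\alpha)}\,L_n^{(\alpha)}(x)$, where $L_n^{(\alpha)}$ are the standard Laguerre polynomials, $\sum_{n\ge0}L_n^{(\alpha)}(x)z^n=(1-z)^{-1-\alpha}\exp(xz/(z-1))$. The W-functions are $\varphi_n(x)=\sqrt{w_\alpha(x)}\,p_n(x)$ and the differentiation matrix is $\mathcal{D}_{m,n}=\int_0^\infty\varphi_m'(x)\varphi_n(x)\,dx$. A weight is separable if there are real sequences $\{a_n\},\{b_n\}$ with $\mathcal{D}_{m,n}=a_mb_n$ for $m\ge n+1$, $\mathcal{D}_{m,m}=0$ and $\mathcal{D}_{m,n}=-a_nb_m$ for $m\le n-1$. *)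

theory Defs
  imports "HOL-Analysis.Analysis" "HOL-Computational_Algebra.Formal_Power_Series"
begin

text \<open>
  An orthonormal polynomial system for the weight \<open>w\<close> on \<open>S\<close>. It determines each \<open>p n\<close> up to
  sign; no sign is prescribed, since the leading coefficient of the standard Laguerre polynomial
  has sign \<open>(-1) ^ n\<close>.
\<close>
definition orthonormal_polys :: "real set \<Rightarrow> (real \<Rightarrow> real) \<Rightarrow> (nat \<Rightarrow> real \<Rightarrow> real) \<Rightarrow> bool" where
  "orthonormal_polys S w p \<longleftrightarrow>
     (\<forall>n. \<exists>q :: real poly. degree q = n \<and> p n = poly q) \<and>
     (\<forall>m n. set_integrable lborel S (\<lambda>x. p m x * p n x * w x) \<and>
            (LBINT x:S. p m x * p n x * w x) = (if m = n then 1 else 0))"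

definition W_fun :: "(real \<Rightarrow> real) \<Rightarrow> (nat \<Rightarrow> real \<Rightarrow> real) \<Rightarrow> nat \<Rightarrow> real \<Rightarrow> real" where
  "W_fun w p n x = sqrt (w x) * p n x"

definition diff_matrix ::
  "real set \<Rightarrow> (real \<Rightarrow> real) \<Rightarrow> (nat \<Rightarrow> real \<Rightarrow> real) \<Rightarrow> nat \<Rightarrow> nat \<Rightarrow> real" where
  "diff_matrix S w p m n = (LBINT x:S. deriv (W_fun w p m) x * W_fun w p n x)"

text \<open>
  Since the Lebesgue integral of a non-integrable function is \<open>0\<close> by convention, existence of the
  integrals is recorded separately.
\<close>
definition diff_matrix_exists ::
  "real set \<Rightarrow> (real \<Rightarrow> real) \<Rightarrow> (nat \<Rightarrow> real \<Rightarrow> real) \<Rightarrow> bool" where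
  "diff_matrix_exists S w p \<longleftrightarrow>
     (\<forall>m n. set_integrable lborel S (\<lambda>x. deriv (W_fun w p m) x * W_fun w p n x))"

text \<open>
  Changing the signs of the \<open>p n\<close> by \<open>s n\<close> replaces \<open>a n\<close>, \<open>b n\<close> by \<open>s n * a n\<close>, \<open>s n * b n\<close>, so
  separability does not depend on which orthonormal system is chosen.
\<close>
definition separable_weight :: "real set \<Rightarrow> (real \<Rightarrow> real) \<Rightarrow> bool" where
  "separable_weight S w \<longleftrightarrow>
     (\<exists>p. orthonormal_polys S w p \<and> diff_matrix_exists S w p \<and>
       (\<exists>a b :: nat \<Rightarrow> real. \<forall>m n.
          (m \<ge> n + 1 \<longrightarrow> diff_matrix S w p m n = a m * b n) \<and>
          diff_matrix S w p m m = 0 \<and>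
          (m + 1 \<le> n \<longrightarrow> diff_matrix S w p m n = - a n * b m)))"

definition laguerre_weight :: "real \<Rightarrow> real \<Rightarrow> real" where
  "laguerre_weight \<alpha> x = x powr \<alpha> * exp (- x)"

text \<open>
  The generating function \<open>(1 - z) powr (-1 - \<alpha>) * exp (x * z / (z - 1))\<close> as a formal power
  series in \<open>z\<close>: \<open>fps_binomial c\<close> is \<open>(1 + z) powr c\<close> and \<open>fps_exp x\<close> is \<open>exp (x * z)\<close>.
\<close>
definition laguerre_gf :: "real \<Rightarrow> real \<Rightarrow> real fps" where
  "laguerre_gf \<alpha> x =
     fps_compose (fps_binomial (- 1 - \<alpha>)) (- fps_X) *
     fps_compose (fps_exp x) (fps_X / (fps_X - 1))"

definition laguerre :: "real \<Rightarrow> nat \<Rightarrow> real \<Rightarrow> real" where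
  "laguerre \<alpha> n x = fps_nth (laguerre_gf \<alpha> x) n"

definition laguerre_orthonormal :: "real \<Rightarrow> nat \<Rightarrow> real \<Rightarrow> real" where
  "laguerre_orthonormal \<alpha> n x = sqrt (fact n / Gamma (real n + 1 + \<alpha>)) * laguerre \<alpha> n x"

definition laguerre_a :: "real \<Rightarrow> nat \<Rightarrow> real" where
  "laguerre_a \<alpha> m = sqrt (fact m / (2 * Gamma (real m + 1 + \<alpha>)))"

definition laguerre_b :: "real \<Rightarrow> nat \<Rightarrow> real" where
  "laguerre_b \<alpha> n = sqrt (Gamma (real n + 1 + \<alpha>) / (2 * fact n))"

end

theory Submission
  imports Defs
begin

text \<open>
  On \<open>x > 0\<close> the product of \<open>\<phi>\<^sub>m'\<close> and \<open>\<phi>\<^sub>n\<close> is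
  \<open>w(x) * (p\<^sub>m' * p\<^sub>n + (\<alpha> / (2 * x) - 1 / 2) * p\<^sub>m * p\<^sub>n)\<close>, where \<open>w\<close> is the Laguerre weight. So every
  entry of the differentiation matrix is a combination of integrals of polynomials against the
  two weights \<open>x powr \<alpha> * exp (-x)\<close> and \<open>x powr (\<alpha> - 1) * exp (-x)\<close>; the second one is integrable
  because \<open>\<alpha> > 0\<close>. Both are instances of one linear functional on polynomials,
  \<open>gamma_integral a\<close>, which sends \<open>x ^ k\<close> to \<open>Gamma (a + k)\<close>.

  The functional equation of \<open>Gamma\<close> is an integration by parts for this functional
  (\<open>gamma_integral_pderiv\<close>). It makes the matrix antisymmetric, so only the entries with \<open>m < n\<close>
  remain. There the first and third terms vanish by orthogonality, since \<open>p\<^sub>m'\<close> and \<open>p\<^sub>m\<close> have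
  degree below \<open>n\<close>. In the middle term, \<open>p\<^sub>m(x) / x\<close> is \<open>p\<^sub>m(0) / x\<close> plus a polynomial of degree below
  \<open>n\<close>, which is again orthogonal to \<open>p\<^sub>n\<close>; hence that term factors as \<open>p\<^sub>m(0)\<close>, which depends only on \<open>m\<close>,
  times the integral of \<open>w(x) * p\<^sub>n(x) / x\<close>, which depends only on \<open>n\<close>. This factorisation is
  separability (\<open>gamma_integral_singular_mult_laguerre\<close>, \<open>diff_form_laguerre\<close>).

  Orthogonality and the remaining integral come from the explicit coefficients of the Laguerre
  polynomials, read off the generating function (\<open>laguerre_eq_poly\<close>). Integrating them term by
  term leaves an \<open>n\<close>-th finite difference: of a polynomial of degree \<open>k \<le> n\<close> for the moments against
  \<open>w\<close> (\<open>alternating_binomial_sum_pochhammer\<close>), and of \<open>1 / (\<alpha> + j)\<close> for the singular weight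
  (\<open>alternating_binomial_sum_inverse\<close>).
\<close>

section \<open>Finite differences as alternating binomial sums\<close>

text \<open>
  The alternating sum is \<open>(1 - E) ^ n\<close> applied to \<open>f\<close> at \<open>0\<close>, with \<open>E\<close> the shift; this peels off one
  factor \<open>1 - E\<close> and is the induction step of both evaluations below.
\<close>
lemma alternating_binomial_sum_Suc:
  fixes f :: "nat \<Rightarrow> real"
  shows "(\<Sum>j\<le>Suc n. (-1) ^ j * real (Suc n choose j) * f j) =
    (\<Sum>j\<le>n. (-1) ^ j * real (n choose j) * (f j - f (Suc j)))"
proof -
  have "(\<Sum>j\<le>Suc n. (-1) ^ j * real (Suc n choose j) * f j) =
      f 0 + (\<Sum>j\<le>n. (-1) ^ Suc j * (real (n choose j) + real (n choose Suc j)) * f (Suc j))"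
    by (subst sum.atMost_Suc_shift) simp
  also have "\<dots> = f 0 + (\<Sum>j\<le>n. (-1) ^ Suc j * real (n choose Suc j) * f (Suc j))
      - (\<Sum>j\<le>n. (-1) ^ j * real (n choose j) * f (Suc j))"
    by (simp add: ring_distribs sum.distrib sum_negf sum_subtractf)
  also have "f 0 + (\<Sum>j\<le>n. (-1) ^ Suc j * real (n choose Suc j) * f (Suc j)) =
      (\<Sum>j\<le>Suc n. (-1) ^ j * real (n choose j) * f j)"
    by (subst sum.atMost_Suc_shift) simp
  also have "\<dots> = (\<Sum>j\<le>n. (-1) ^ j * real (n choose j) * f j)"
    by simp
  finally show ?thesis
    by (simp add: right_diff_distrib sum_subtractf)
qed

text \<open>
  The Pochhammer symbol is a monic polynomial of degree \<open>k\<close> in \<open>j\<close>, so its \<open>n\<close>-th difference vanishes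
  for \<open>k < n\<close> and is \<open>(-1) ^ n * fact n\<close> for \<open>k = n\<close>. One difference step turns
  \<open>pochhammer z k\<close> into \<open>- k * pochhammer (z + 1) (k - 1)\<close>, which keeps the family closed.
\<close>
lemma alternating_binomial_sum_pochhammer:
  fixes c :: real
  assumes "k \<le> n"
  shows "(\<Sum>j\<le>n. (-1) ^ j * real (n choose j) * pochhammer (c + real j) k) =
    (if k = n then (-1) ^ n * fact n else 0)"
  using assms
proof (induction n arbitrary: c k)
  case 0
  then show ?case by simp
next
  case (Suc n)
  show ?case
  proof (cases k)
    case 0
    then show ?thesis
      unfolding alternating_binomial_sum_Suc by simp
  next
    case (Suc i)
    have diff: "pochhammer z (Suc i) - pochhammer (z + 1) (Suc i) =
        - real (Suc i) * pochhammer (z + 1) i" for z :: real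
      by (subst pochhammer_rec, subst pochhammer_rec') (simp add: algebra_simps)
    have "(\<Sum>j\<le>Suc n. (-1) ^ j * real (Suc n choose j) * pochhammer (c + real j) k) =
        (\<Sum>j\<le>n. - real (Suc i) * ((-1) ^ j * real (n choose j) * pochhammer ((c + 1) + real j) i))"
      unfolding alternating_binomial_sum_Suc
    proof (rule sum.cong[OF refl])
      fix j
      show "(-1) ^ j * real (n choose j) * (pochhammer (c + real j) k - pochhammer (c + real (Suc j)) k)
        = - real (Suc i) * ((-1) ^ j * real (n choose j) * pochhammer ((c + 1) + real j) i)"
        using diff[of "c + real j"] by (simp add: Suc add_ac mult_ac del: pochhammer_Suc)
    qed
    also have "\<dots> = - real (Suc i) * (if i = n then (-1) ^ n * fact n else 0)"
      using Suc.prems Suc Suc.IH[of i "c + 1"] by (simp only: sum_distrib_left[symmetric])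
    also have "\<dots> = (if k = Suc n then (-1) ^ Suc n * fact (Suc n) else 0)"
      using Suc by (simp add: algebra_simps)
    finally show ?thesis .
  qed
qed

text \<open>
  This is the partial fraction expansion of \<open>fact n / (c * (c + 1) * ... * (c + n))\<close>.
\<close>
lemma alternating_binomial_sum_inverse:
  fixes c :: real
  assumes "c > 0"
  shows "(\<Sum>j\<le>n. (-1) ^ j * real (n choose j) * (1 / (c + real j))) =
    fact n / pochhammer c (Suc n)"
  using assms
proof (induction n arbitrary: c)
  case 0
  then show ?case by simp
next
  case (Suc n)
  have pos: "pochhammer (c + 1) n > 0"
    using Suc.prems by (intro pochhammer_pos) simp
  have "(\<Sum>j\<le>Suc n. (-1) ^ j * real (Suc n choose j) * (1 / (c + real j))) =
      (\<Sum>j\<le>n. (-1) ^ j * real (n choose j) * (1 / (c + real j))) -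
      (\<Sum>j\<le>n. (-1) ^ j * real (n choose j) * (1 / ((c + 1) + real j)))"
    unfolding alternating_binomial_sum_Suc
    by (simp add: right_diff_distrib sum_subtractf add_ac)
  also have "\<dots> = fact n / pochhammer c (Suc n) - fact n / pochhammer (c + 1) (Suc n)"
    using Suc.prems Suc.IH[of c] Suc.IH[of "c + 1"] by simp
  also have "\<dots> = fact n / (c * pochhammer (c + 1) n)
      - fact n / ((c + 1 + real n) * pochhammer (c + 1) n)"
    by (subst pochhammer_rec, subst pochhammer_rec') simp
  also have "\<dots> = fact (Suc n) / (c * ((c + 1 + real n) * pochhammer (c + 1) n))"
    using pos Suc.prems by (simp add: divide_simps) (simp add: algebra_simps)
  also have "\<dots> = fact (Suc n) / pochhammer c (Suc (Suc n))"
    by (subst pochhammer_rec, subst pochhammer_rec') simp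
  finally show ?case .
qed

section \<open>Polynomials integrated against the Gamma density\<close>

definition gamma_integral :: "real \<Rightarrow> real poly \<Rightarrow> real" where
  "gamma_integral a p = (LBINT x:{0<..}. x powr (a - 1) * exp (- x) * poly p x)"

lemma has_bochner_integral_Gamma:
  fixes a :: real
  assumes "a > 0"
  shows "has_bochner_integral lborel
    (\<lambda>x. indicator {0<..} x * (x powr (a - 1) * exp (- x))) (Gamma a)"
proof (rule has_bochner_integral_nn_integral)
  have "(\<lambda>x::real. indicator {0<..} x * (x powr (a - 1) * exp (- x))) =
      (\<lambda>x. indicator {0..} x * x powr (a - 1) / exp x)"
    by (auto simp: fun_eq_iff indicator_def exp_minus field_simps)
  then show "(\<integral>\<^sup>+x. ennreal (indicator {0<..} x * (x powr (a - 1) * exp (- x))) \<partial>lborel)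
      = ennreal (Gamma a)"
    using Gamma_conv_nn_integral_real[OF assms] by (simp add: fun_eq_iff)
qed (use assms Gamma_real_pos[of a] in \<open>auto simp: less_imp_le\<close>)

lemma set_integrable_Gamma:
  fixes a :: real
  shows "a > 0 \<Longrightarrow> set_integrable lborel {0<..} (\<lambda>x::real. x powr (a - 1) * exp (- x))"
  using has_bochner_integral_Gamma[of a]
  by (simp add: set_integrable_def has_bochner_integral_iff)

lemma set_lebesgue_integral_Gamma:
  fixes a :: real
  shows "a > 0 \<Longrightarrow> (LBINT x:{0<..}. x powr (a - 1) * exp (- x)) = Gamma a"
  using has_bochner_integral_Gamma[of a]
  by (simp add: set_lebesgue_integral_def has_bochner_integral_iff)

text \<open>
  Splitting off the constant coefficient leaves an integrand of the same shape with \<open>a\<close> raised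
  by one, so facts for all \<open>a > 0\<close> follow by induction on the polynomial.
\<close>
lemma gamma_integrand_pCons:
  fixes x a :: real
  assumes "x \<in> {0<..}"
  shows "x powr (a - 1) * exp (- x) * poly (pCons c p) x =
    c * (x powr (a - 1) * exp (- x)) + x powr (a + 1 - 1) * exp (- x) * poly p x"
  using assms powr_add[of x "a - 1" 1] by (simp add: algebra_simps)

lemma gamma_integrable:
  fixes p :: "real poly" and a :: real
  shows "a > 0 \<Longrightarrow> set_integrable lborel {0<..} (\<lambda>x. x powr (a - 1) * exp (- x) * poly p x)"
proof (induction p arbitrary: a)
  case 0
  then show ?case by (simp add: set_integrable_def)
next
  case (pCons c p)
  have "set_integrable lborel {0<..}
      (\<lambda>x. c * (x powr (a - 1) * exp (- x)) + x powr (a + 1 - 1) * exp (- x) * poly p x)"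
    using pCons.prems
    by (intro set_integral_add(1) pCons.IH set_integrable_mult_right[OF set_integrable_Gamma]) auto
  then show ?case
    by (subst set_integrable_cong[OF refl refl gamma_integrand_pCons]) auto
qed

lemma gamma_integral_pCons:
  assumes "a > 0"
  shows "gamma_integral a (pCons c p) = c * Gamma a + gamma_integral (a + 1) p"
proof -
  have "gamma_integral a (pCons c p) = (LBINT x:{0<..}. c * (x powr (a - 1) * exp (- x))
      + x powr (a + 1 - 1) * exp (- x) * poly p x)"
    unfolding gamma_integral_def
    by (rule set_lebesgue_integral_cong) (use gamma_integrand_pCons in auto)
  also have "\<dots> = (LBINT x:{0<..}. c * (x powr (a - 1) * exp (- x)))
      + gamma_integral (a + 1) p"
    unfolding gamma_integral_def using assms
    by (intro set_integral_add set_integrable_mult_right set_integrable_Gamma gamma_integrable) auto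
  finally show ?thesis
    using assms by (simp add: set_lebesgue_integral_Gamma)
qed

lemma gamma_integral_0 [simp]: "gamma_integral a 0 = 0"
  by (simp add: gamma_integral_def set_lebesgue_integral_def)

lemma gamma_integral_add:
  "a > 0 \<Longrightarrow> gamma_integral a (p + q) = gamma_integral a p + gamma_integral a q"
  unfolding gamma_integral_def
  by (subst set_integral_add(2)[symmetric]) (auto intro: gamma_integrable simp: ring_distribs)

lemma gamma_integral_smult:
  "gamma_integral a (smult c p) = c * gamma_integral a p"
  unfolding gamma_integral_def
  by (subst set_integral_mult_right[symmetric]) (simp add: mult_ac)

lemma gamma_integral_diff:
  "a > 0 \<Longrightarrow> gamma_integral a (p - q) = gamma_integral a p - gamma_integral a q"
  using gamma_integral_add[of a p "smult (-1) q"] gamma_integral_smult[of a "-1" q] by simp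

lemma gamma_integral_sum:
  "a > 0 \<Longrightarrow> gamma_integral a (\<Sum>i\<in>I. f i) = (\<Sum>i\<in>I. gamma_integral a (f i))"
  by (induction I rule: infinite_finite_induct) (auto simp: gamma_integral_add)

lemma gamma_integral_monom:
  "a > 0 \<Longrightarrow> gamma_integral a (monom c k) = c * Gamma (a + real k)"
  by (induction k arbitrary: a)
     (auto simp: monom_0 monom_Suc gamma_integral_pCons add_ac)

text \<open>
  Integration by parts: the boundary terms of \<open>x powr a * exp (-x) * poly p x\<close> vanish at \<open>0\<close> and at
  infinity. On monomials it is the functional equation of \<open>Gamma\<close>, so no limits are needed.
\<close>
lemma gamma_integral_pderiv:
  "a > 0 \<Longrightarrow> gamma_integral (a + 1) (pderiv p) =
     gamma_integral (a + 1) p - a * gamma_integral a p"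
proof (induction p arbitrary: a)
  case 0
  then show ?case by simp
next
  case (pCons c p)
  have "Gamma (a + 1) = a * Gamma a"
    using pCons.prems by (intro Gamma_plus1) (auto elim!: nonpos_Ints_cases)
  then show ?case
    using pCons.prems pCons.IH[of "a + 1"]
    by (simp add: pderiv_pCons gamma_integral_add gamma_integral_pCons algebra_simps)
qed

section \<open>Explicit Laguerre polynomials from the generating function\<close>

definition laguerre_poly :: "real \<Rightarrow> nat \<Rightarrow> real poly" where
  "laguerre_poly \<alpha> n =
     (\<Sum>j\<le>n. monom ((-1) ^ j / fact j * (pochhammer (1 + \<alpha> + real j) (n - j) / fact (n - j))) j)"

text \<open>
  With \<open>z\<close> for \<open>fps_X\<close>: since \<open>z / (z - 1) = - z * (1 - z) powr (-1)\<close>, each power of it only lowers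
  the exponent of the binomial series by \<open>i\<close> and shifts by \<open>(- z) ^ i\<close>.
\<close>
lemma fps_binomial_times_power:
  "fps_compose (fps_binomial (- c)) (- fps_X) * (fps_X / (fps_X - 1)) ^ i =
    (- fps_X) ^ i * fps_compose (fps_binomial (- (c + real i))) (- fps_X :: real fps)"
proof -
  have "inverse (1 - fps_X) = fps_compose (fps_binomial (-1)) (- fps_X :: real fps)"
    unfolding fps_binomial_minus_one
    by (subst fps_inverse_compose) (auto simp: fps_compose_add_distrib)
  moreover have "fps_X / (fps_X - 1) = - fps_X * inverse (1 - fps_X :: real fps)"
  proof -
    have "fps_X - 1 = - (1 - fps_X :: real fps)" by simp
    then have "inverse (fps_X - 1 :: real fps) = - inverse (1 - fps_X)"
      by (metis fps_inverse_minus)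
    then show ?thesis
      by (subst fps_divide_unit) auto
  qed
  ultimately have "(fps_X / (fps_X - 1)) ^ i =
      (- fps_X) ^ i * fps_compose (fps_binomial (- real i)) (- fps_X :: real fps)"
    using fps_compose_power[of "- fps_X" "fps_binomial (- 1 :: real)" i, symmetric]
    by (simp only: power_mult_distrib fps_binomial_power) simp
  then show ?thesis
    by (simp add: mult_ac fps_compose_mult_distrib[symmetric] fps_binomial_add_mult[symmetric])
qed

lemma fps_nth_binomial_uminus:
  "fps_nth (fps_compose (fps_binomial (- c)) (- fps_X)) n = pochhammer c n / (fact n :: real)"
  by (simp add: fps_compose_uminus' gbinomial_pochhammer)

text \<open>
  Expanding the exponential in the generating function, the coefficient of \<open>x ^ i / fact i\<close> is
  \<open>(1 - z) powr (-1 - \<alpha>) * (z / (z - 1)) ^ i\<close>, a shifted binomial series.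
\<close>
lemma laguerre_eq_poly: "laguerre \<alpha> n x = poly (laguerre_poly \<alpha> n) x"
proof -
  let ?f = "fps_compose (fps_binomial (- (1 + \<alpha>))) (- fps_X) :: real fps"
  let ?u = "fps_X / (fps_X - 1) :: real fps"
  have u0: "fps_nth ?u 0 = 0"
    by (subst fps_divide_unit) auto
  have c: "- 1 - \<alpha> = - (1 + \<alpha>)"
    by simp
  have "laguerre \<alpha> n x = (\<Sum>k=0..n. fps_nth ?f k * fps_nth (fps_compose (fps_exp x) ?u) (n - k))"
    unfolding laguerre_def laguerre_gf_def c by (rule fps_mult_nth)
  also have "\<dots> = (\<Sum>k=0..n. fps_nth ?f k * (\<Sum>i=0..n. x ^ i / fact i * fps_nth (?u ^ i) (n - k)))"
  proof (intro sum.cong refl arg_cong2[where f = "(*)"])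
    fix k
    \<comment> \<open>The terms added for \<open>i > n - k\<close> vanish because \<open>?u\<close> has no constant term; they make the
      range of \<open>i\<close> independent of \<open>k\<close>, so that the sums can be interchanged.\<close>
    show "fps_nth (fps_compose (fps_exp x) ?u) (n - k) =
        (\<Sum>i=0..n. x ^ i / fact i * fps_nth (?u ^ i) (n - k))"
      unfolding fps_compose_nth
      by (rule sum.mono_neutral_cong_left) (auto simp: startsby_zero_power_prefix[OF u0])
  qed
  also have "\<dots> = (\<Sum>i=0..n. x ^ i / fact i * fps_nth (?f * ?u ^ i) n)"
    unfolding fps_mult_nth sum_distrib_left
    by (subst sum.swap) (simp add: mult_ac)
  also have "\<dots> = (\<Sum>i\<le>n. x ^ i / fact i * ((-1) ^ i * (pochhammer (1 + \<alpha> + real i) (n - i) / fact (n - i))))"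
  proof (intro sum.cong refl arg_cong2[where f = "(*)"])
    fix i assume "i \<in> {..n}"
    have "fps_const ((-1) ^ i) = (-1 :: real fps) ^ i"
      by (simp flip: fps_const_power fps_const_neg)
    then have uminus: "(- fps_X :: real fps) ^ i = fps_const ((-1) ^ i) * fps_X ^ i"
      by (simp only: power_minus[of "fps_X :: real fps"])
    show "fps_nth (?f * ?u ^ i) n =
        (-1) ^ i * (pochhammer (1 + \<alpha> + real i) (n - i) / fact (n - i))"
      using \<open>i \<in> {..n}\<close> unfolding fps_binomial_times_power uminus
      by (simp add: mult.assoc fps_X_power_mult_nth fps_nth_binomial_uminus del: minus_add_distrib)
  qed (auto simp: atLeast0AtMost)
  finally show ?thesis
    by (simp add: laguerre_poly_def poly_sum poly_monom mult_ac)
qed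


section \<open>Moments and orthogonality of the Laguerre polynomials\<close>

text \<open>
  This form separates the binomial coefficients from a \<open>Gamma\<close> denominator that cancels against
  the moments, which is what turns the moment sums into finite differences.
\<close>
lemma laguerre_coefficient_Gamma:
  assumes "\<alpha> > 0" "j \<le> n"
  shows "(-1) ^ j / fact j * (pochhammer (1 + \<alpha> + real j) (n - j) / fact (n - j)) =
    Gamma (real n + 1 + \<alpha>) / fact n *
      ((-1) ^ j * real (n choose j) / Gamma (\<alpha> + 1 + real j))"
proof -
  have "1 + \<alpha> + real j \<notin> \<int>\<^sub>\<le>\<^sub>0"
    using assms by (auto elim!: nonpos_Ints_cases)
  then have "pochhammer (1 + \<alpha> + real j) (n - j) =
      Gamma (real n + 1 + \<alpha>) / Gamma (\<alpha> + 1 + real j)"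
    using assms by (subst pochhammer_Gamma) (auto simp: of_nat_diff add_ac)
  then show ?thesis
    using assms by (simp add: binomial_fact mult_ac)
qed

lemma gamma_integral_monom_mult_laguerre:
  assumes "\<alpha> > 0" "a > 0"
  shows "gamma_integral a (monom 1 k * laguerre_poly \<alpha> n) =
    Gamma (real n + 1 + \<alpha>) / fact n *
      (\<Sum>j\<le>n. (-1) ^ j * real (n choose j) * (Gamma (a + real j + real k) / Gamma (\<alpha> + 1 + real j)))"
proof -
  have "gamma_integral a (monom 1 k * laguerre_poly \<alpha> n) =
      (\<Sum>j\<le>n. (-1) ^ j / fact j * (pochhammer (1 + \<alpha> + real j) (n - j) / fact (n - j)) *
        Gamma (a + real j + real k))"
    using assms unfolding laguerre_poly_def sum_distrib_left
    by (simp add: gamma_integral_sum gamma_integral_monom mult_monom add_ac)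
  also have "\<dots> = (\<Sum>j\<le>n. Gamma (real n + 1 + \<alpha>) / fact n *
      ((-1) ^ j * real (n choose j) / Gamma (\<alpha> + 1 + real j)) * Gamma (a + real j + real k))"
    by (rule sum.cong[OF refl], subst laguerre_coefficient_Gamma[OF assms(1)]) auto
  finally show ?thesis
    by (simp add: sum_distrib_left mult_ac)
qed

text \<open>
  The \<open>k\<close>-th moment is an \<open>n\<close>-th difference of a Pochhammer symbol of order \<open>k\<close>, so of \<open>p\<close> only the
  coefficient of degree \<open>n\<close> is seen. In particular the Laguerre polynomial is orthogonal to all
  polynomials of lower degree.
\<close>
lemma gamma_integral_mult_laguerre:
  assumes "\<alpha> > 0" "degree p \<le> n"
  shows "gamma_integral (\<alpha> + 1) (p * laguerre_poly \<alpha> n) =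
    coeff p n * ((-1) ^ n * Gamma (real n + 1 + \<alpha>))"
proof -
  have monom: "gamma_integral (\<alpha> + 1) (monom 1 k * laguerre_poly \<alpha> n) =
      (if k = n then (-1) ^ n * Gamma (real n + 1 + \<alpha>) else 0)" if "k \<le> n" for k
  proof -
    have "Gamma (\<alpha> + 1 + real j + real k) / Gamma (\<alpha> + 1 + real j) =
        pochhammer (\<alpha> + 1 + real j) k" for j
      using assms by (subst pochhammer_Gamma) (auto elim!: nonpos_Ints_cases)
    then show ?thesis
      using assms alternating_binomial_sum_pochhammer[OF that, of "\<alpha> + 1"]
      by (subst gamma_integral_monom_mult_laguerre) auto
  qed
  have "p = (\<Sum>k\<le>n. smult (coeff p k) (monom 1 k))"
    using poly_as_sum_of_monoms'[OF assms(2)] by (simp add: smult_monom)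
  then have "gamma_integral (\<alpha> + 1) (p * laguerre_poly \<alpha> n) =
      gamma_integral (\<alpha> + 1) (\<Sum>k\<le>n. smult (coeff p k) (monom 1 k * laguerre_poly \<alpha> n))"
    by (metis (no_types, lifting) mult_smult_left sum.cong sum_distrib_right)
  also have "\<dots> = (\<Sum>k\<le>n. coeff p k * (if k = n then (-1) ^ n * Gamma (real n + 1 + \<alpha>) else 0))"
    using assms monom by (simp add: gamma_integral_sum gamma_integral_smult)
  also have "\<dots> = (\<Sum>k\<le>n. if k = n then coeff p k * ((-1) ^ n * Gamma (real n + 1 + \<alpha>)) else 0)"
    by (rule sum.cong) auto
  finally show ?thesis
    by simp
qed

text \<open>
  Against the weight with exponent lowered by one the quotient of \<open>Gamma\<close> values is
  \<open>1 / (\<alpha> + j)\<close>, and its \<open>n\<close>-th difference cancels the normalisation entirely: the value does not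
  depend on \<open>n\<close>.
\<close>
lemma gamma_integral_laguerre:
  assumes "\<alpha> > 0"
  shows "gamma_integral \<alpha> (laguerre_poly \<alpha> n) = Gamma \<alpha>"
proof -
  have Gamma: "Gamma (\<alpha> + real j) / Gamma (\<alpha> + 1 + real j) = 1 / (\<alpha> + real j)" for j
  proof -
    have "\<alpha> + real j > 0" using assms by simp
    moreover from this have "\<alpha> + real j \<notin> \<int>\<^sub>\<le>\<^sub>0" by (auto elim!: nonpos_Ints_cases)
    moreover have "Gamma (\<alpha> + real j) \<noteq> 0"
      using Gamma_real_pos[OF \<open>\<alpha> + real j > 0\<close>] by linarith
    ultimately show ?thesis
      using Gamma_plus1[of "\<alpha> + real j"] by (simp add: add_ac divide_simps)
  qed
  have pos: "Gamma (real n + 1 + \<alpha>) > 0" "Gamma \<alpha> > 0"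
    using assms by auto
  have "\<alpha> \<notin> \<int>\<^sub>\<le>\<^sub>0"
    using assms by (auto elim!: nonpos_Ints_cases)
  then have poch: "pochhammer \<alpha> (Suc n) = Gamma (real n + 1 + \<alpha>) / Gamma \<alpha>"
    by (subst pochhammer_Gamma) (auto simp: add_ac)
  have "gamma_integral \<alpha> (laguerre_poly \<alpha> n) = Gamma (real n + 1 + \<alpha>) / fact n *
      (\<Sum>j\<le>n. (-1) ^ j * real (n choose j) * (1 / (\<alpha> + real j)))"
    using gamma_integral_monom_mult_laguerre[OF assms assms, of 0 n] by (simp add: Gamma)
  then show ?thesis
    using pos unfolding alternating_binomial_sum_inverse[OF assms] poch by simp
qed

text \<open>
  Writing \<open>p = p(0) + x * r\<close>, the factor \<open>x\<close> turns the singular weight into the Laguerre weight, to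
  which \<open>r\<close>, of degree below \<open>n\<close>, contributes nothing. This is the origin of separability.
\<close>
lemma gamma_integral_singular_mult_laguerre:
  assumes "\<alpha> > 0" "degree p \<le> n"
  shows "gamma_integral \<alpha> (p * laguerre_poly \<alpha> n) = poly p 0 * Gamma \<alpha>"
proof (cases p)
  case (pCons c r)
  have "degree r \<le> n" "coeff r n = 0"
  proof -
    have "r = 0 \<or> degree r < n"
      using assms(2) pCons by (auto simp: degree_pCons_eq_if split: if_splits)
    then show "degree r \<le> n" "coeff r n = 0"
      by (auto simp: coeff_eq_0)
  qed
  then have "gamma_integral (\<alpha> + 1) (r * laguerre_poly \<alpha> n) = 0"
    using gamma_integral_mult_laguerre[OF assms(1)] by simp
  then show ?thesis
    using assms(1) pCons
    by (simp add: mult_pCons_left gamma_integral_add gamma_integral_smult gamma_integral_pCons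
        gamma_integral_laguerre)
qed

lemma coeff_laguerre_poly:
  "coeff (laguerre_poly \<alpha> n) j =
     (if j \<le> n then (-1) ^ j / fact j * (pochhammer (1 + \<alpha> + real j) (n - j) / fact (n - j)) else 0)"
  by (simp add: laguerre_poly_def coeff_sum)

lemma degree_laguerre_poly: "degree (laguerre_poly \<alpha> n) = n"
  by (rule antisym[OF degree_le le_degree]) (auto simp: coeff_laguerre_poly)

lemma poly_laguerre_0:
  assumes "\<alpha> > 0"
  shows "poly (laguerre_poly \<alpha> n) 0 = Gamma (real n + 1 + \<alpha>) / (fact n * Gamma (\<alpha> + 1))"
  using assms laguerre_coefficient_Gamma[OF assms, of 0 n]
  by (simp add: poly_0_coeff_0 coeff_laguerre_poly)

lemma laguerre_orthogonal:
  assumes "\<alpha> > 0"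
  shows "gamma_integral (\<alpha> + 1) (laguerre_poly \<alpha> m * laguerre_poly \<alpha> n) =
    (if m = n then Gamma (real n + 1 + \<alpha>) / fact n else 0)"
proof -
  have *: "gamma_integral (\<alpha> + 1) (laguerre_poly \<alpha> m * laguerre_poly \<alpha> n) =
    (if m = n then Gamma (real n + 1 + \<alpha>) / fact n else 0)" if "m \<le> n" for m n
    using that assms
    by (subst gamma_integral_mult_laguerre)
       (auto simp: degree_laguerre_poly coeff_laguerre_poly field_simps simp flip: power_add mult_2)
  show ?thesis
    using *[of m n] *[of n m] by (cases "m \<le> n") (auto simp: mult.commute)
qed

lemma gamma_integral_singular_laguerre_product:
  assumes "\<alpha> > 0" "m \<le> n"
  shows "gamma_integral \<alpha> (laguerre_poly \<alpha> m * laguerre_poly \<alpha> n) =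
    Gamma (real m + 1 + \<alpha>) / (\<alpha> * fact m)"
proof -
  have "\<alpha> \<notin> \<int>\<^sub>\<le>\<^sub>0"
    using assms by (auto elim!: nonpos_Ints_cases)
  then have "Gamma (\<alpha> + 1) = \<alpha> * Gamma \<alpha>"
    by (rule Gamma_plus1)
  moreover have "Gamma \<alpha> \<noteq> 0"
    using Gamma_real_pos[OF assms(1)] by linarith
  ultimately show ?thesis
    using assms
    by (simp add: gamma_integral_singular_mult_laguerre degree_laguerre_poly poly_laguerre_0)
qed

section \<open>The differentiation matrix\<close>

text \<open>
  The bilinear form on polynomials whose values at the orthonormal polynomials are the entries of
  the differentiation matrix. The term with \<open>\<alpha> / (2 * x)\<close> appears as an integral against the weight
  with exponent \<open>\<alpha> - 1\<close>.
\<close>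
definition diff_form :: "real \<Rightarrow> real poly \<Rightarrow> real poly \<Rightarrow> real" where
  "diff_form \<alpha> p q = gamma_integral (\<alpha> + 1) (pderiv p * q - smult (1 / 2) (p * q))
     + gamma_integral \<alpha> (smult (\<alpha> / 2) (p * q))"

text \<open>
  The symmetrisation in \<open>p\<close> and \<open>q\<close> is the integral of the derivative of \<open>w * p * q\<close>, which is
  zero by integration by parts applied to \<open>p * q\<close>.
\<close>
lemma diff_form_antisym:
  assumes "\<alpha> > 0"
  shows "diff_form \<alpha> p q = - diff_form \<alpha> q p"
  using assms gamma_integral_pderiv[OF assms, of "p * q"]
  by (simp add: diff_form_def gamma_integral_diff gamma_integral_smult pderiv_mult
      gamma_integral_add mult.commute algebra_simps)

lemma diff_form_smult:
  "\<alpha> > 0 \<Longrightarrow> diff_form \<alpha> (smult c p) (smult d q) = c * d * diff_form \<alpha> p q"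
  by (simp add: diff_form_def gamma_integral_diff gamma_integral_smult pderiv_smult algebra_simps)

text \<open>
  Only the singular term survives: the derivative and the polynomial itself both have degree
  below \<open>n\<close>.
\<close>
lemma diff_form_laguerre:
  assumes "\<alpha> > 0" "m < n"
  shows "diff_form \<alpha> (laguerre_poly \<alpha> m) (laguerre_poly \<alpha> n) =
    Gamma (real m + 1 + \<alpha>) / (2 * fact m)"
proof -
  have "degree (pderiv (laguerre_poly \<alpha> m)) < n"
    using assms(2) by (simp add: degree_pderiv degree_laguerre_poly)
  then have "gamma_integral (\<alpha> + 1) (pderiv (laguerre_poly \<alpha> m) * laguerre_poly \<alpha> n) = 0"
    using assms(1) by (simp add: gamma_integral_mult_laguerre coeff_eq_0)
  then show ?thesis
    using assms
    by (simp add: diff_form_def gamma_integral_diff gamma_integral_smult laguerre_orthogonal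
        gamma_integral_singular_laguerre_product)
qed

text \<open>
  The two factors \<open>sqrt w\<close> recombine to \<open>w\<close>, and \<open>w' / w = \<alpha> / x - 1\<close>. The exponent is left as
  \<open>\<alpha> + 1 - 1\<close> so that both summands are literally integrands of \<open>gamma_integral\<close>.
\<close>
lemma deriv_W_fun_times_W_fun:
  fixes x \<alpha> :: real
  assumes "x > 0"
  shows "deriv (W_fun (laguerre_weight \<alpha>) (\<lambda>n. poly (p n)) m) x *
      W_fun (laguerre_weight \<alpha>) (\<lambda>n. poly (p n)) n x =
    x powr (\<alpha> + 1 - 1) * exp (- x) * poly (pderiv (p m) * p n - smult (1 / 2) (p m * p n)) x +
    x powr (\<alpha> - 1) * exp (- x) * poly (smult (\<alpha> / 2) (p m * p n)) x"
proof -
  define w where "w = x powr \<alpha> * exp (- x)"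
  have w: "w > 0" "sqrt w * sqrt w = w"
    using assms by (auto simp: w_def)
  have cancel: "(inverse s / 2 * (s * s * t) * u + v * s) * (s * y) =
      s * s * t / 2 * (u * y) + s * s * (v * y)" if "s \<noteq> 0" for s t u v y :: real
    using that by (simp add: field_simps)
  have powr: "x powr (\<alpha> - 1) = x powr \<alpha> / x"
    using assms by (simp add: powr_diff)
  have "((\<lambda>x. x powr \<alpha> * exp (- x)) has_real_derivative w * (\<alpha> / x - 1)) (at x)"
    using assms powr unfolding w_def
    by (auto intro!: derivative_eq_intros simp: algebra_simps)
  from DERIV_chain2[OF DERIV_real_sqrt this] w(1)
  have "((\<lambda>x. sqrt (x powr \<alpha> * exp (- x))) has_real_derivative
      inverse (sqrt w) / 2 * (w * (\<alpha> / x - 1))) (at x)"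
    unfolding w_def by simp
  from DERIV_mult[OF this poly_DERIV[of "p m" x]]
  have "(W_fun (laguerre_weight \<alpha>) (\<lambda>n. poly (p n)) m has_real_derivative
      (inverse (sqrt w) / 2 * (w * (\<alpha> / x - 1)) * poly (p m) x + poly (pderiv (p m)) x * sqrt w)) (at x)"
    by (simp add: W_fun_def[abs_def] laguerre_weight_def w_def)
  then have "deriv (W_fun (laguerre_weight \<alpha>) (\<lambda>n. poly (p n)) m) x *
      W_fun (laguerre_weight \<alpha>) (\<lambda>n. poly (p n)) n x =
     (inverse (sqrt w) / 2 * (w * (\<alpha> / x - 1)) * poly (p m) x + poly (pderiv (p m)) x * sqrt w)
       * (sqrt w * poly (p n) x)"
    by (simp add: DERIV_imp_deriv W_fun_def laguerre_weight_def w_def)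
  also have "\<dots> = w * (\<alpha> / x - 1) / 2 * (poly (p m) x * poly (p n) x)
      + w * (poly (pderiv (p m)) x * poly (p n) x)"
    using w(1) cancel[of "sqrt w" "\<alpha> / x - 1" "poly (p m) x" "poly (pderiv (p m)) x" "poly (p n) x"]
    unfolding w(2) by simp
  finally show ?thesis
    using powr by (simp add: w_def algebra_simps add_divide_distrib diff_divide_distrib)
qed

lemma diff_matrix_laguerre_weight:
  assumes "\<alpha> > 0"
  shows "diff_matrix_exists {0<..} (laguerre_weight \<alpha>) (\<lambda>n. poly (p n))"
    and "diff_matrix {0<..} (laguerre_weight \<alpha>) (\<lambda>n. poly (p n)) m n = diff_form \<alpha> (p m) (p n)"
proof -
  have pos: "\<alpha> + 1 > 0" using assms by simp
  show "diff_matrix_exists {0<..} (laguerre_weight \<alpha>) (\<lambda>n. poly (p n))"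
    unfolding diff_matrix_exists_def
  proof (intro allI)
    fix m n
    show "set_integrable lborel {0<..} (\<lambda>x. deriv (W_fun (laguerre_weight \<alpha>) (\<lambda>n. poly (p n)) m) x *
      W_fun (laguerre_weight \<alpha>) (\<lambda>n. poly (p n)) n x)"
      using set_integral_add(1)[OF gamma_integrable[OF pos] gamma_integrable[OF assms]]
      by (subst set_integrable_cong[OF refl refl deriv_W_fun_times_W_fun]) (simp, blast)
  qed
  have "diff_matrix {0<..} (laguerre_weight \<alpha>) (\<lambda>n. poly (p n)) m n =
    (LBINT x:{0<..}. x powr (\<alpha> + 1 - 1) * exp (- x) * poly (pderiv (p m) * p n - smult (1 / 2) (p m * p n)) x +
    x powr (\<alpha> - 1) * exp (- x) * poly (smult (\<alpha> / 2) (p m * p n)) x)"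
    unfolding diff_matrix_def
    by (rule set_lebesgue_integral_cong) (use deriv_W_fun_times_W_fun in auto)
  also have "\<dots> = diff_form \<alpha> (p m) (p n)"
    unfolding diff_form_def gamma_integral_def
    by (rule set_integral_add(2)[OF gamma_integrable[OF pos] gamma_integrable[OF assms]])
  finally show "diff_matrix {0<..} (laguerre_weight \<alpha>) (\<lambda>n. poly (p n)) m n = diff_form \<alpha> (p m) (p n)" .
qed

section \<open>Separability of the Laguerre weight\<close>

definition laguerre_orthonormal_poly :: "real \<Rightarrow> nat \<Rightarrow> real poly" where
  "laguerre_orthonormal_poly \<alpha> n =
     smult (sqrt (fact n / Gamma (real n + 1 + \<alpha>))) (laguerre_poly \<alpha> n)"

lemma laguerre_orthonormal_eq_poly:
  "laguerre_orthonormal \<alpha> = (\<lambda>n. poly (laguerre_orthonormal_poly \<alpha> n))"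
  by (simp add: fun_eq_iff laguerre_orthonormal_def laguerre_orthonormal_poly_def laguerre_eq_poly)

lemma orthonormal_polys_laguerre:
  assumes "\<alpha> > 0"
  shows "orthonormal_polys {0<..} (laguerre_weight \<alpha>) (laguerre_orthonormal \<alpha>)"
  unfolding orthonormal_polys_def laguerre_orthonormal_eq_poly
proof (intro conjI allI)
  fix m n
  have Gamma_nz: "Gamma (real k + 1 + \<alpha>) \<noteq> 0" for k
    using assms Gamma_real_pos[of "real k + 1 + \<alpha>"] by linarith
  let ?p = "laguerre_orthonormal_poly \<alpha>"
  have "degree (?p n) = n"
    using Gamma_nz[of n] by (simp add: laguerre_orthonormal_poly_def degree_laguerre_poly)
  then show "\<exists>q. degree q = n \<and> poly (?p n) = poly q"
    by blast
  have eq: "(\<lambda>x. poly (?p m) x * poly (?p n) x * laguerre_weight \<alpha> x) =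
      (\<lambda>x. x powr (\<alpha> + 1 - 1) * exp (- x) * poly (?p m * ?p n) x)"
    by (simp add: fun_eq_iff laguerre_weight_def mult_ac)
  show "set_integrable lborel {0<..} (\<lambda>x. poly (?p m) x * poly (?p n) x * laguerre_weight \<alpha> x)"
    unfolding eq by (rule gamma_integrable) (use assms in simp)
  have "(LBINT x:{0<..}. poly (?p m) x * poly (?p n) x * laguerre_weight \<alpha> x) =
      gamma_integral (\<alpha> + 1) (?p m * ?p n)"
    unfolding eq gamma_integral_def ..
  also have "\<dots> = (if m = n then 1 else 0)"
    using assms Gamma_nz[of n]
    by (simp add: laguerre_orthonormal_poly_def gamma_integral_smult laguerre_orthogonal
        real_sqrt_divide divide_simps)
  finally show "(LBINT x:{0<..}. poly (?p m) x * poly (?p n) x * laguerre_weight \<alpha> x) =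
      (if m = n then 1 else 0)" .
qed

lemma diff_matrix_laguerre_upper:
  assumes "\<alpha> > 0" "m < n"
  shows "diff_matrix {0<..} (laguerre_weight \<alpha>) (laguerre_orthonormal \<alpha>) m n =
    laguerre_a \<alpha> n * laguerre_b \<alpha> m"
proof -
  \<comment> \<open>\<open>G k\<close> is the squared norm of the \<open>k\<close>-th Laguerre polynomial.\<close>
  define G where "G k = Gamma (real k + 1 + \<alpha>) / fact k" for k :: nat
  have G: "G k > 0" for k
    using assms(1) by (simp add: G_def)
  have "diff_matrix {0<..} (laguerre_weight \<alpha>) (laguerre_orthonormal \<alpha>) m n =
      sqrt (1 / G m) * sqrt (1 / G n) * (G m / 2)"
    using assms unfolding laguerre_orthonormal_eq_poly diff_matrix_laguerre_weight(2)[OF assms(1)]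
    by (simp add: laguerre_orthonormal_poly_def diff_form_smult diff_form_laguerre G_def)
  also have "\<dots> = sqrt ((1 / G m) * (1 / G n) * (G m / 2)\<^sup>2)"
    using G[of m] by (simp only: real_sqrt_mult) (simp add: real_sqrt_abs)
  also have "(1 / G m) * (1 / G n) * (G m / 2)\<^sup>2 = (1 / (2 * G n)) * (G m / 2)"
    using G[of m] G[of n] by (simp add: power2_eq_square field_simps)
  also have "sqrt \<dots> = laguerre_a \<alpha> n * laguerre_b \<alpha> m"
    unfolding real_sqrt_mult by (simp add: G_def laguerre_a_def laguerre_b_def mult.commute)
  finally show ?thesis .
qed

lemma diff_matrix_laguerre_antisym:
  assumes "\<alpha> > 0"
  shows "diff_matrix {0<..} (laguerre_weight \<alpha>) (laguerre_orthonormal \<alpha>) m n =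
    - diff_matrix {0<..} (laguerre_weight \<alpha>) (laguerre_orthonormal \<alpha>) n m"
  unfolding laguerre_orthonormal_eq_poly diff_matrix_laguerre_weight(2)[OF assms]
  by (rule diff_form_antisym[OF assms])

theorem theorem12:
  fixes \<alpha> :: real
  assumes "\<alpha> > 0"
  shows "separable_weight {0<..} (laguerre_weight \<alpha>) \<and>
    diff_matrix_exists {0<..} (laguerre_weight \<alpha>) (laguerre_orthonormal \<alpha>) \<and>
    (\<forall>m n.
      (m \<ge> n + 1 \<longrightarrow>
        diff_matrix {0<..} (laguerre_weight \<alpha>) (laguerre_orthonormal \<alpha>) m n
          = - laguerre_a \<alpha> m * laguerre_b \<alpha> n) \<and>
      diff_matrix {0<..} (laguerre_weight \<alpha>) (laguerre_orthonormal \<alpha>) m m = 0 \<and>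
      (m + 1 \<le> n \<longrightarrow>
        diff_matrix {0<..} (laguerre_weight \<alpha>) (laguerre_orthonormal \<alpha>) m n
          = laguerre_a \<alpha> n * laguerre_b \<alpha> m))"
proof -
  let ?D = "diff_matrix {0<..} (laguerre_weight \<alpha>) (laguerre_orthonormal \<alpha>)"
  have ex: "diff_matrix_exists {0<..} (laguerre_weight \<alpha>) (laguerre_orthonormal \<alpha>)"
    unfolding laguerre_orthonormal_eq_poly by (rule diff_matrix_laguerre_weight(1)[OF assms])
  have upper: "?D m n = laguerre_a \<alpha> n * laguerre_b \<alpha> m" if "m + 1 \<le> n" for m n
    using diff_matrix_laguerre_upper[OF assms] that by simp
  have diag: "?D m m = 0" for m
    using diff_matrix_laguerre_antisym[OF assms, of m m] by simp
  have lower: "?D m n = - laguerre_a \<alpha> m * laguerre_b \<alpha> n" if "m \<ge> n + 1" for m n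
    using diff_matrix_laguerre_antisym[OF assms, of m n] upper[OF that] by simp
  have "separable_weight {0<..} (laguerre_weight \<alpha>)"
    unfolding separable_weight_def
  proof (intro exI conjI)
    \<comment> \<open>The standard Laguerre sign puts the minus below the diagonal; it is absorbed into \<open>a\<close>.\<close>
    show "\<forall>m n. (m \<ge> n + 1 \<longrightarrow> ?D m n = (- laguerre_a \<alpha> m) * laguerre_b \<alpha> n) \<and> ?D m m = 0 \<and>
        (m + 1 \<le> n \<longrightarrow> ?D m n = - (- laguerre_a \<alpha> n) * laguerre_b \<alpha> m)"
      using upper lower diag by simp
  qed (use ex orthonormal_polys_laguerre[OF assms] in auto)
  then show ?thesis
    using ex upper lower diag by blast
qed

end
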